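(* Let $\mu$ be a compactly supported probability measure on $\mathbb{R}$ with infinitely many points in its support, with $n$th Christoffel-Darboux kernel $K_n$, and fix $x\in\mathbb{R}$. If there exists a number $\rho(x)>0$ such that for any $a,b\in\mathbb{R}$, $$\lim_{n\to\infty}\frac{K_n\left(x+\frac{a}{n},x+\frac{b}{n}\right)}{K_n(x,x)}=\frac{\sin\left(\pi\rho(x)(b-a)\right)}{\pi\rho(x)(b-a)},$$ then $$\lim_{n\to\infty}K_n(x,x)=\infty.$$
   Context: Let $\{p_n\}_{n=0}^\infty$ be the orthonormal polynomials of $\mu$ (so $\deg p_n=n$ and $p_0\equiv1$). The $n$th Christoffel-Darboux kernel of $\mu$ is $K_n(x,y)=\sum_{j=0}^{n-1}p_j(x)p_j(y)$. The quotient $\frac{\sin(\pi\rho(x)(b-a))}{\pi\rho(x)(b-a)}$ is interpreted as $1$ when $a=b$. *)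

theory Defs
  imports
    "HOL-Probability.Probability"
    "HOL-Computational_Algebra.Polynomial"
begin

definition measure_support :: "'a::topological_space measure \<Rightarrow> 'a set" where
  "measure_support M = {x. \<forall>U. open U \<longrightarrow> x \<in> U \<longrightarrow> emeasure M U > 0}"

(* The conditions determine each p n with n > 0 only up to sign; the kernel below does not
   depend on the choice. The library integral is 0 for a non-integrable function, so the
   second conjunct is meaningful only for measures with finite moments, in particular for
   finite Borel measures of compact support. *)
definition orthonormal_polynomials :: "real measure \<Rightarrow> (nat \<Rightarrow> real poly) \<Rightarrow> bool" where
  "orthonormal_polynomials \<mu> p \<longleftrightarrow>
     p 0 = 1 \<and>
     (\<forall>m n. (\<integral>t. poly (p m) t * poly (p n) t \<partial>\<mu>) = (if m = n then 1 else 0)) \<and>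
     (\<forall>n. degree (p n) = n)"

definition CD_kernel :: "(nat \<Rightarrow> real poly) \<Rightarrow> nat \<Rightarrow> real \<Rightarrow> real \<Rightarrow> real" where
  "CD_kernel p n x y = (\<Sum>j<n. poly (p j) x * poly (p j) y)"

end

theory Submission
  imports Defs
begin

text \<open>
  Write \<open>K\<^sub>n\<close> for the kernel.  The hypothesis is applied at two scales at the same points: since
  \<open>x + b/n = x + 2b/(2n)\<close>, it gives the limits of both \<open>K\<^sub>n\<close> and \<open>K\<^sub>2\<^sub>n\<close> at \<open>(x, x + b/n)\<close>, relative to
  \<open>K\<^sub>n(x,x)\<close> and \<open>K\<^sub>2\<^sub>n(x,x)\<close>.  The two limits are the values of the sinc function at \<open>\<pi>\<rho>b\<close> and
  \<open>2\<pi>\<rho>b\<close>, and these differ for \<open>b = 1/(2\<rho>)\<close>: they are \<open>2/\<pi>\<close> and \<open>0\<close>.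

  The diagonal \<open>K\<^sub>n(x,x)\<close> is nondecreasing in \<open>n\<close>, so if it does not tend to infinity it has a
  finite limit \<open>L\<close>, and \<open>L \<ge> p\<^sub>0(x)\<^sup>2 = 1\<close>.  Then \<open>K\<^sub>2\<^sub>n(x,x) - K\<^sub>n(x,x)\<close> tends to \<open>0\<close>, while
  \<open>K\<^sub>2\<^sub>n(x + b/n, x + b/n)\<close> tends to \<open>L\<close> by the hypothesis on the diagonal.  By the Cauchy-Schwarz
  inequality (\<open>CD_kernel_increment_Cauchy_Schwarz\<close>) the increment
  \<open>K\<^sub>2\<^sub>n(x, x + b/n) - K\<^sub>n(x, x + b/n)\<close> tends to \<open>0\<close>.  But by the choice of \<open>b\<close> it tends to
  \<open>0 - 2L/\<pi>\<close>, a contradiction.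
\<close>

lemma CD_kernel_diff:
  assumes "n \<le> m"
  shows "CD_kernel p m x y - CD_kernel p n x y = (\<Sum>j=n..<m. poly (p j) x * poly (p j) y)"
  using sum_diff_nat_ivl[of 0 n m "\<lambda>j. poly (p j) x * poly (p j) y"] assms
  by (simp add: CD_kernel_def atLeast0LessThan)

lemma CD_kernel_diag_nonneg: "0 \<le> CD_kernel p n y y"
  by (simp add: CD_kernel_def sum_nonneg)

lemma incseq_CD_kernel_diag: "incseq (\<lambda>n. CD_kernel p n x x)"
  by (rule incseq_SucI) (simp add: CD_kernel_def)

lemma CD_kernel_increment_Cauchy_Schwarz:
  assumes "n \<le> m"
  shows "(CD_kernel p m x y - CD_kernel p n x y)\<^sup>2
           \<le> (CD_kernel p m x x - CD_kernel p n x x) * CD_kernel p m y y"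
proof -
  have "(CD_kernel p m x y - CD_kernel p n x y)\<^sup>2
      \<le> (CD_kernel p m x x - CD_kernel p n x x) * (CD_kernel p m y y - CD_kernel p n y y)"
    using Cauchy_Schwarz_ineq_sum[of "\<lambda>j. poly (p j) x" "\<lambda>j. poly (p j) y" "{n..<m}"]
    by (simp add: CD_kernel_diff[OF assms] power2_eq_square)
  also have "\<dots> \<le> (CD_kernel p m x x - CD_kernel p n x x) * CD_kernel p m y y"
    using incseqD[OF incseq_CD_kernel_diag assms, of p x] CD_kernel_diag_nonneg[of p n y]
    by (intro mult_left_mono) auto
  finally show ?thesis .
qed

lemma incseq_at_top_or_convergent:
  fixes f :: "nat \<Rightarrow> real"
  assumes "incseq f" and "\<not> filterlim f at_top sequentially"
  obtains L where "f \<longlonglongrightarrow> L" and "\<And>n. f n \<le> L"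
proof -
  obtain Z where Z: "\<And>N. \<exists>n\<ge>N. f n < Z"
    using assms(2) unfolding filterlim_at_top eventually_sequentially by (meson not_le)
  have "f n \<le> Z" for n
    using Z[of n] incseqD[OF assms(1)] by (meson less_imp_le order_trans)
  with assms(1) show thesis
    using incseq_convergent[of f Z] that by blast
qed

theorem theorem1p7:
  fixes \<mu> :: "real measure" and p :: "nat \<Rightarrow> real poly" and x :: real
  assumes "prob_space \<mu>"
    and "sets \<mu> = sets borel"
    and "compact (measure_support \<mu>)"
    and "infinite (measure_support \<mu>)"
    and "orthonormal_polynomials \<mu> p"
    and "\<exists>\<rho>::real. \<rho> > 0 \<and>
           (\<forall>a b :: real.
              (\<lambda>n. CD_kernel p n (x + a / real n) (x + b / real n) / CD_kernel p n x x)
                \<longlonglongrightarrow> (if a = b then 1 else sin (pi * \<rho> * (b - a)) / (pi * \<rho> * (b - a))))"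
  shows "filterlim (\<lambda>n. CD_kernel p n x x) at_top sequentially"
proof (rule ccontr)
  let ?K = "\<lambda>n. CD_kernel p n x x"
  assume "\<not> filterlim ?K at_top sequentially"
  then obtain L where L: "?K \<longlonglongrightarrow> L" and K_le: "\<And>n. ?K n \<le> L"
    using incseq_at_top_or_convergent[OF incseq_CD_kernel_diag] by blast
  have "?K 1 = 1"
    using assms(5) by (simp add: CD_kernel_def orthonormal_polynomials_def)
  then have "L \<ge> 1" using K_le[of 1] by simp
  have K_nz: "eventually (\<lambda>n. ?K n \<noteq> 0) sequentially"
    using eventually_ge_at_top[of 1]
  proof eventually_elim
    case (elim n)
    then show ?case
      using incseqD[OF incseq_CD_kernel_diag elim, of p x] \<open>?K 1 = 1\<close> by simp
  qed
  obtain \<rho> where "\<rho> > 0" and univ: "\<And>a b.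
      (\<lambda>n. CD_kernel p n (x + a / real n) (x + b / real n) / ?K n)
        \<longlonglongrightarrow> (if a = b then 1 else sin (pi * \<rho> * (b - a)) / (pi * \<rho> * (b - a)))"
    using assms(6) by blast
  have unnormalised: "(\<lambda>n. CD_kernel p n (x + a / real n) (x + b / real n))
      \<longlonglongrightarrow> (if a = b then 1 else sin (pi * \<rho> * (b - a)) / (pi * \<rho> * (b - a))) * L" for a b
    using tendsto_mult[OF univ[of a b] L]
    by (rule Lim_transform_eventually) (use K_nz in eventually_elim, simp)

  define b where "b = 1 / (2 * \<rho>)"
  define y where "y n = x + b / real n" for n
  have "b \<noteq> 0" and pib: "pi * \<rho> * b = pi / 2" and pi2b: "pi * \<rho> * (2 * b) = pi"
    using \<open>\<rho> > 0\<close> by (auto simp: b_def field_simps)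
  have double: "x + 2 * b / real (2 * n) = y n" for n
    by (simp add: y_def)
  have subseq: "strict_mono (\<lambda>n::nat. 2 * n)"
    by (simp add: strict_mono_def)

  have lim_n: "(\<lambda>n. CD_kernel p n x (y n)) \<longlonglongrightarrow> 2 / pi * L"
    using unnormalised[of 0 b] \<open>b \<noteq> 0\<close> by (simp add: y_def pib)
  have lim_2n: "(\<lambda>n. CD_kernel p (2 * n) x (y n)) \<longlonglongrightarrow> 0"
    using LIMSEQ_subseq_LIMSEQ[OF unnormalised[of 0 "2 * b"] subseq] \<open>b \<noteq> 0\<close>
    by (simp add: o_def double pi2b del: of_nat_mult)
  have lim_2n_diag: "(\<lambda>n. CD_kernel p (2 * n) (y n) (y n)) \<longlonglongrightarrow> L"
    using LIMSEQ_subseq_LIMSEQ[OF unnormalised[of "2 * b" "2 * b"] subseq]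
    by (simp add: o_def double del: of_nat_mult)
  have "(\<lambda>n. ?K (2 * n)) \<longlonglongrightarrow> L"
    using LIMSEQ_subseq_LIMSEQ[OF L subseq] by (simp add: o_def)
  then have bound: "(\<lambda>n. (?K (2 * n) - ?K n) * CD_kernel p (2 * n) (y n) (y n)) \<longlonglongrightarrow> 0"
    using tendsto_mult[OF tendsto_diff[OF _ L] lim_2n_diag] by fastforce

  have "(\<lambda>n. (CD_kernel p (2 * n) x (y n) - CD_kernel p n x (y n))\<^sup>2) \<longlonglongrightarrow> (0 - 2 / pi * L)\<^sup>2"
    by (intro tendsto_intros lim_n lim_2n)
  moreover have "(CD_kernel p (2 * n) x (y n) - CD_kernel p n x (y n))\<^sup>2
      \<le> (?K (2 * n) - ?K n) * CD_kernel p (2 * n) (y n) (y n)" for n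
    by (rule CD_kernel_increment_Cauchy_Schwarz) simp
  ultimately have "(0 - 2 / pi * L)\<^sup>2 \<le> 0"
    using LIMSEQ_le[OF _ bound] by blast
  then show False
    using \<open>L \<ge> 1\<close> by simp
qed

end
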